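(* A class $\mathcal{G}$ of bipartite graphs has bounded pathwidth if and only if there exist $k,s,t\in\mathbb{N}$ such that every graph in $\mathcal{G}$ has a 2-layer drawing with no $k$-crossing and no $(s,t)$-crossing.
   Context: $\mathbb{N}=\{1,2,3,\dots\}$ denotes the positive integers. Graphs are finite and simple. A class $\mathcal{G}$ of graphs has bounded pathwidth if there is an integer $c$ such that every graph in $\mathcal{G}$ has pathwidth at most $c$. A 2-layer drawing of a bipartite graph $G$ with bipartition $\{A,B\}$ positions the vertices in $A$ at distinct points on a horizontal line, positions the vertices in $B$ at distinct points on a different horizontal line, and draws each edge as a straight line-segment. Equivalently, it is given by total orders $\preceq_A$ on $A$ and $\preceq_B$ on $B$ (left-to-right orders); two edges $vw$ and $xy$ with $v,x\in A$ and $w,y\in B$ cross if and only if ($v\prec_A x$ and $y\prec_B w$) or ($x\prec_A v$ and $w\prec_B y$). In particular, edges sharing an end-vertex do not cross. A matching in a graph is a set of edges, no two of which are incident to a common vertex; a $k$-matching is a matching of size $k$. In a 2-layer drawing, a $k$-crossing is a set of $k$ pairwise crossing edges (necessarily a $k$-matching). A set of edges in a 2-layer drawing is non-crossing if no two edges in it cross. In a 2-layer drawing, an $(s,t)$-crossing is a pair $(S,T)$ where $S$ is a non-crossing $s$-matching, $T$ is a non-crossing $t$-matching, and every edge in $S$ crosses every edge in $T$. A path-decomposition of a graph $G$ is a sequence $(B_1,\dots,B_n)$ of subsets of $V(G)$ (called bags) such that $B_1\cup\dots\cup B_n=V(G)$, both end-vertices of each edge of $G$ lie in a common bag, and $B_i\cap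 B_k\subseteq B_j$ whenever $1\leq i<j<k\leq n$. Its width is $\max_i|B_i|-1$. The pathwidth of $G$ is the minimum width of a path-decomposition of $G$. *)

theory Defs
  imports Main
begin

type_synonym 'a graph = "'a set \<times> 'a set set"

abbreviation verts :: "'a graph \<Rightarrow> 'a set" where
  "verts G \<equiv> fst G"

abbreviation edges :: "'a graph \<Rightarrow> 'a set set" where
  "edges G \<equiv> snd G"

definition finite_simple_graph :: "'a graph \<Rightarrow> bool" where
  "finite_simple_graph G \<longleftrightarrow>
     finite (verts G) \<and> (\<forall>e\<in>edges G. e \<subseteq> verts G \<and> card e = 2)"

definition bipartition :: "'a graph \<Rightarrow> 'a set \<Rightarrow> 'a set \<Rightarrow> bool" where
  "bipartition G A B \<longleftrightarrow>
     A \<union> B = verts G \<and> A \<inter> B = {} \<and> (\<forall>e\<in>edges G. \<exists>a\<in>A. \<exists>b\<in>B. e = {a, b})"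

definition bipartite :: "'a graph \<Rightarrow> bool" where
  "bipartite G \<longleftrightarrow> (\<exists>A B. bipartition G A B)"

(* The bags are numbered from 0. The sequence is nonempty, so that the maximum in the
   width exists; the graph without vertices has pathwidth -1, hence the type int. *)
definition path_decomposition :: "'a graph \<Rightarrow> 'a set list \<Rightarrow> bool" where
  "path_decomposition G Bs \<longleftrightarrow>
     Bs \<noteq> [] \<and>
     \<Union>(set Bs) = verts G \<and>
     (\<forall>e\<in>edges G. \<exists>X\<in>set Bs. e \<subseteq> X) \<and>
     (\<forall>i j k. i < j \<and> j < k \<and> k < length Bs \<longrightarrow> Bs ! i \<inter> Bs ! k \<subseteq> Bs ! j)"

definition decomposition_width :: "'a set list \<Rightarrow> int" where
  "decomposition_width Bs = int (Max (card ` set Bs)) - 1"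

definition pathwidth :: "'a graph \<Rightarrow> int" where
  "pathwidth G = (LEAST w. \<exists>Bs. path_decomposition G Bs \<and> decomposition_width Bs = w)"

definition bounded_pathwidth :: "'a graph set \<Rightarrow> bool" where
  "bounded_pathwidth \<G> \<longleftrightarrow> (\<exists>c::int. \<forall>G\<in>\<G>. pathwidth G \<le> c)"

(* LEAST on int is only meaningful if a minimum exists, which is the case here. *)
lemma pathwidth_attained:
  assumes "finite_simple_graph G"
  shows "\<exists>Bs. path_decomposition G Bs \<and> decomposition_width Bs = pathwidth G"
    and "path_decomposition G Bs \<Longrightarrow> pathwidth G \<le> decomposition_width Bs"
proof -
  let ?m = "\<lambda>Bs. Max (card ` set Bs)"
  have "path_decomposition G [verts G]"
    using assms by (auto simp: path_decomposition_def finite_simple_graph_def)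
  then obtain Cs where Cs: "path_decomposition G Cs"
    and min: "\<And>Bs. path_decomposition G Bs \<Longrightarrow> ?m Cs \<le> ?m Bs"
    using ex_has_least_nat[of "path_decomposition G" _ ?m] by blast
  have le: "decomposition_width Cs \<le> decomposition_width Bs" if "path_decomposition G Bs" for Bs
    using min[OF that] unfolding decomposition_width_def by linarith
  have eq: "pathwidth G = decomposition_width Cs"
    unfolding pathwidth_def by (rule Least_equality) (use Cs le in blast)+
  show "\<exists>Bs. path_decomposition G Bs \<and> decomposition_width Bs = pathwidth G"
    using Cs eq by auto
  show "pathwidth G \<le> decomposition_width Bs" if "path_decomposition G Bs"
    using le[OF that] eq by simp
qed

record 'a drawing =
  side_A :: "'a set"
  side_B :: "'a set"
  order_A :: "'a rel"
  order_B :: "'a rel"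

(* The orders are the reflexive left-to-right orders of the vertices on the two lines. *)
definition two_layer_drawing :: "'a graph \<Rightarrow> 'a drawing \<Rightarrow> bool" where
  "two_layer_drawing G D \<longleftrightarrow>
     bipartition G (side_A D) (side_B D) \<and>
     linear_order_on (side_A D) (order_A D) \<and>
     linear_order_on (side_B D) (order_B D)"

definition before :: "'a rel \<Rightarrow> 'a \<Rightarrow> 'a \<Rightarrow> bool" where
  "before r x y \<longleftrightarrow> (x, y) \<in> r \<and> x \<noteq> y"

definition crosses :: "'a drawing \<Rightarrow> 'a set \<Rightarrow> 'a set \<Rightarrow> bool" where
  "crosses D e f \<longleftrightarrow>
     (\<exists>v\<in>side_A D. \<exists>w\<in>side_B D. \<exists>x\<in>side_A D. \<exists>y\<in>side_B D.
        e = {v, w} \<and> f = {x, y} \<and>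
        (before (order_A D) v x \<and> before (order_B D) y w \<or>
         before (order_A D) x v \<and> before (order_B D) w y))"

definition k_matching :: "'a graph \<Rightarrow> nat \<Rightarrow> 'a set set \<Rightarrow> bool" where
  "k_matching G k M \<longleftrightarrow> M \<subseteq> edges G \<and> pairwise disjnt M \<and> finite M \<and> card M = k"

definition k_crossing :: "'a graph \<Rightarrow> 'a drawing \<Rightarrow> nat \<Rightarrow> 'a set set \<Rightarrow> bool" where
  "k_crossing G D k M \<longleftrightarrow>
     M \<subseteq> edges G \<and> finite M \<and> card M = k \<and> pairwise (crosses D) M"

definition non_crossing :: "'a drawing \<Rightarrow> 'a set set \<Rightarrow> bool" where
  "non_crossing D M \<longleftrightarrow> (\<forall>e\<in>M. \<forall>f\<in>M. \<not> crosses D e f)"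

definition st_crossing ::
    "'a graph \<Rightarrow> 'a drawing \<Rightarrow> nat \<Rightarrow> nat \<Rightarrow> 'a set set \<Rightarrow> 'a set set \<Rightarrow> bool" where
  "st_crossing G D s t S T \<longleftrightarrow>
     k_matching G s S \<and> non_crossing D S \<and>
     k_matching G t T \<and> non_crossing D T \<and>
     (\<forall>e\<in>S. \<forall>f\<in>T. crosses D e f)"

end

theory Submission
  imports Defs "HOL-Library.Ramsey"
begin

text \<open>A path-decomposition gives a drawing by ordering both sides by the first bag containing a
  vertex: large crossings of either kind force many vertices into one bag.

  Conversely, sweep a drawing with a cut that splits each of the two lines into a left and a right
  part. The edges leaving the left part of the first line cross all edges leaving the left part
  of the second line, so by Ramsey's theorem one of the two sets has a small vertex cover, and
  the cut can be advanced on the line where this keeps both covers small. This gives a vertex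
  order in which the edges across every cut have a small vertex cover. Minimum covers chosen as
  far to the left as possible are nested by a submodularity argument, and the union of the
  covers of consecutive cuts with the vertex in between gives a path-decomposition.\<close>

section \<open>Vertex covers of edge sets and the matchings that obstruct them\<close>

definition coverable :: "'a set set \<Rightarrow> nat \<Rightarrow> bool" where
  "coverable E n \<longleftrightarrow> (\<exists>C. finite C \<and> card C \<le> n \<and> (\<forall>e\<in>E. e \<inter> C \<noteq> {}))"

lemma coverable_mono: "coverable E n \<Longrightarrow> F \<subseteq> E \<Longrightarrow> n \<le> m \<Longrightarrow> coverable F m"
  unfolding coverable_def by (meson le_trans subset_iff)

lemma coverable_empty: "coverable {} n"
  unfolding coverable_def by (auto intro: exI[of _ "{}"])

lemma coverable_insert_vertex:
  assumes "coverable E n" "\<And>e. e \<in> F \<Longrightarrow> e \<in> E \<or> v \<in> e"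
  shows "coverable F (Suc n)"
proof -
  obtain C where C: "finite C" "card C \<le> n" "\<forall>e\<in>E. e \<inter> C \<noteq> {}"
    using assms(1) unfolding coverable_def by blast
  have "card (insert v C) \<le> Suc n"
    using C(1,2) by (simp add: card_insert_if)
  moreover have "\<forall>e\<in>F. e \<inter> insert v C \<noteq> {}"
    using C(3) assms(2) by blast
  ultimately show ?thesis
    unfolding coverable_def using C(1) by blast
qed

lemma coverable_Un:
  assumes "coverable E m" "coverable F n"
  shows "coverable (E \<union> F) (m + n)"
proof -
  obtain C where C: "finite C" "card C \<le> m" "\<forall>e\<in>E. e \<inter> C \<noteq> {}"
    using assms(1) unfolding coverable_def by blast
  obtain D where D: "finite D" "card D \<le> n" "\<forall>e\<in>F. e \<inter> D \<noteq> {}"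
    using assms(2) unfolding coverable_def by blast
  have "card (C \<union> D) \<le> m + n"
    using card_Un_le[of C D] C(2) D(2) by linarith
  moreover have "\<forall>e\<in>E \<union> F. e \<inter> (C \<union> D) \<noteq> {}"
    using C(3) D(3) by blast
  ultimately show ?thesis
    unfolding coverable_def using C(1) D(1) by blast
qed

text \<open>Greedy extension: a matching of \<open>n\<close> edges touches at most
  \<open>2 * n\<close> vertices. These do not cover \<open>E\<close>, so some edge of
  \<open>E\<close> avoids all of them and can be added.\<close>

lemma matching_if_not_coverable:
  assumes "\<not> coverable E (2 * n)" and card2: "\<And>e. e \<in> E \<Longrightarrow> card e = 2"
  shows "\<exists>M. M \<subseteq> E \<and> pairwise disjnt M \<and> finite M \<and> card M = n"
  using assms(1)
proof (induction n)
  case 0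
  then show ?case by (auto intro: exI[of _ "{}"])
next
  case (Suc n)
  then have "\<not> coverable E (2 * n)"
    using coverable_mono[of E "2 * n" E "2 * Suc n"] by auto
  with Suc.IH obtain M where M: "M \<subseteq> E" "pairwise disjnt M" "finite M" "card M = n"
    by blast
  have "card (\<Union>M) \<le> (\<Sum>e\<in>M. card e)"
    using card_Union_le_sum_card by blast
  also have "\<dots> = (\<Sum>e\<in>M. 2)"
    using M(1) card2 by (intro sum.cong) auto
  finally have "card (\<Union>M) \<le> 2 * Suc n"
    using M(4) by simp
  moreover have fin: "finite (\<Union>M)"
    using M(1,3) card2 by (metis card.infinite finite_Union subsetD zero_neq_numeral)
  ultimately obtain e where e: "e \<in> E" "e \<inter> \<Union>M = {}"
    using Suc.prems unfolding coverable_def by blast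
  have "e \<noteq> {}"
    using card2[OF e(1)] by auto
  then have "e \<notin> M"
    using e(2) by blast
  moreover have "pairwise disjnt (insert e M)"
    using M(2) e(2) unfolding pairwise_insert disjnt_def by blast
  ultimately show ?case
    using M e(1) by (intro exI[of _ "insert e M"]) auto
qed

section \<open>Path-decompositions from vertex orders with small cuts\<close>

definition cut_edges :: "'a set set \<Rightarrow> 'a set \<Rightarrow> 'a set set" where
  "cut_edges E P = {e \<in> E. e \<inter> P \<noteq> {} \<and> \<not> e \<subseteq> P}"

definition cut_cover :: "'a graph \<Rightarrow> 'a set \<Rightarrow> 'a set \<Rightarrow> bool" where
  "cut_cover G P C \<longleftrightarrow> C \<subseteq> verts G \<and> (\<forall>e\<in>cut_edges (edges G) P. e \<inter> C \<noteq> {})"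

text \<open>Minimal weight means minimum size and, among the minimum covers, as few vertices
  outside \<open>P\<close> as possible; this choice makes the covers of successive cuts nested.\<close>

definition cover_weight :: "'a graph \<Rightarrow> 'a set \<Rightarrow> 'a set \<Rightarrow> nat" where
  "cover_weight G P C = Suc (card (verts G)) * card C + card (C - P)"

definition least_cover :: "'a graph \<Rightarrow> 'a set \<Rightarrow> 'a set" where
  "least_cover G P = (ARG_MIN (cover_weight G P) C. cut_cover G P C)"

lemma
  assumes "finite_simple_graph G"
  shows least_cover: "cut_cover G P (least_cover G P)"
    and least_cover_le: "cut_cover G P C \<Longrightarrow> cover_weight G P (least_cover G P) \<le> cover_weight G P C"
proof -
  have "cut_cover G P (verts G)"
    using assms unfolding cut_cover_def cut_edges_def finite_simple_graph_def by auto
  then show "cut_cover G P (least_cover G P)"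
    and "cut_cover G P C \<Longrightarrow> cover_weight G P (least_cover G P) \<le> cover_weight G P C"
    unfolding least_cover_def by (metis arg_min_nat_lemma)+
qed

lemma card_least_cover:
  assumes G: "finite_simple_graph G" and "coverable (cut_edges (edges G) P) m"
  shows "card (least_cover G P) \<le> m"
proof -
  let ?n = "card (verts G)"
  have fin: "finite (verts G)"
    using G unfolding finite_simple_graph_def by blast
  obtain C where C: "finite C" "card C \<le> m" "\<forall>e\<in>cut_edges (edges G) P. e \<inter> C \<noteq> {}"
    using assms(2) unfolding coverable_def by blast
  \<comment> \<open>The cover supplied by \<open>coverable\<close> may contain elements that are not
    vertices of \<open>G\<close>. Discarding them keeps it a cover, since edges lie inside
    \<open>verts G\<close>.\<close>
  have "cut_cover G P (C \<inter> verts G)"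
    using C(3) G unfolding cut_cover_def cut_edges_def finite_simple_graph_def by blast
  then have "cover_weight G P (least_cover G P) \<le> cover_weight G P (C \<inter> verts G)"
    by (rule least_cover_le[OF G])
  moreover have "card (C \<inter> verts G) \<le> m"
    using C(1,2) by (meson card_mono inf_le1 le_trans)
  moreover have "card (C \<inter> verts G - P) \<le> ?n"
    using fin by (intro card_mono) auto
  ultimately have "Suc ?n * card (least_cover G P) \<le> Suc ?n * m + ?n"
    unfolding cover_weight_def
    by (smt (verit) add_le_mono le_add1 le_trans mult_le_mono2)
  \<comment> \<open>The secondary term of the weight is at most \<open>?n\<close>, hence smaller
    than the factor \<open>Suc ?n\<close>, so it cannot make up for one additional vertex.\<close>
  then have "Suc ?n * card (least_cover G P) < Suc ?n * Suc m"
    by simp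
  then show ?thesis
    by (simp only: mult_less_cancel1 less_Suc_eq_le)
qed

text \<open>Uncrossing: exchanging parts of the two covers yields covers of the same two cuts with
  the same total size, and minimality of both weights then leaves no room for a difference. As the
  cut advances, a vertex can thus only enter the covers before it is passed and only leave them
  afterwards.\<close>

lemma least_cover_nested:
  assumes G: "finite_simple_graph G" and v: "v \<in> verts G" "v \<notin> P" and P: "P \<subseteq> verts G"
  shows "least_cover G P - insert v P \<subseteq> least_cover G (insert v P)"
    and "least_cover G (insert v P) \<inter> P \<subseteq> least_cover G P"
proof -
  let ?n = "card (verts G)" and ?Q = "insert v P"
  define C where "C = least_cover G P"
  define D where "D = least_cover G ?Q"
  have fin: "finite (verts G)"
    using G unfolding finite_simple_graph_def by blast
  have C: "cut_cover G P C" and D: "cut_cover G ?Q D"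
    unfolding C_def D_def using least_cover[OF G] by auto
  have CV: "C \<subseteq> verts G" and DV: "D \<subseteq> verts G"
    using C D unfolding cut_cover_def by auto
  have finC: "finite C" and finD: "finite D"
    using CV DV fin finite_subset by auto
  \<comment> \<open>\<open>C'\<close> takes the union on \<open>P\<close> and the intersection
    outside \<open>?Q\<close>; \<open>D'\<close> does the opposite. At \<open>v\<close> each keeps
    its own choice. The sizes of \<open>C'\<close> and \<open>D'\<close> add up to those of
    \<open>C\<close> and \<open>D\<close>.\<close>
  define C' where "C' = (C \<union> D) \<inter> P \<union> C \<inter> {v} \<union> (C \<inter> D - ?Q)"
  define D' where "D' = C \<inter> D \<inter> P \<union> D \<inter> {v} \<union> ((C \<union> D) - ?Q)"
  have edge: "\<exists>x y. e = {x, y} \<and> x \<in> R \<and> y \<notin> R" if "e \<in> cut_edges (edges G) R" for e R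
  proof -
    have "card e = 2"
      using that G unfolding cut_edges_def finite_simple_graph_def by auto
    then obtain x y where "e = {x, y}" "x \<noteq> y"
      by (auto simp: card_2_iff)
    then show ?thesis
      using that unfolding cut_edges_def by auto
  qed
  \<comment> \<open>An edge ending in \<open>v\<close> is covered because \<open>C'\<close> contains
    all of \<open>C\<close> on \<open>P\<close> and at \<open>v\<close>. Any other edge crosses both
    cuts, so either its left end lies in one of the covers or its right end lies in both. The
    argument for \<open>D'\<close> is the mirror image.\<close>
  have "e \<inter> C' \<noteq> {}" if e: "e \<in> cut_edges (edges G) P" for e
  proof -
    obtain x y where xy: "e = {x, y}" "x \<in> P" "y \<notin> P"
      using edge[OF e] by blast
    have c: "x \<in> C \<or> y \<in> C"
      using C e xy(1) unfolding cut_cover_def by auto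
    show ?thesis
    proof (cases "y = v")
      case True
      then show ?thesis using c xy unfolding C'_def by auto
    next
      case False
      then have "e \<in> cut_edges (edges G) ?Q"
        using e xy unfolding cut_edges_def by auto
      then have "x \<in> D \<or> y \<in> D"
        using D xy(1) unfolding cut_cover_def by auto
      then show ?thesis
        using c xy False unfolding C'_def by auto
    qed
  qed
  then have C': "cut_cover G P C'"
    using CV DV unfolding cut_cover_def C'_def by blast
  have "e \<inter> D' \<noteq> {}" if e: "e \<in> cut_edges (edges G) ?Q" for e
  proof -
    obtain x y where xy: "e = {x, y}" "x \<in> ?Q" "y \<notin> ?Q"
      using edge[OF e] by blast
    have d: "x \<in> D \<or> y \<in> D"
      using D e xy(1) unfolding cut_cover_def by auto
    show ?thesis
    proof (cases "x = v")
      case True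
      then show ?thesis using d xy unfolding D'_def by auto
    next
      case False
      then have "e \<in> cut_edges (edges G) P"
        using e xy unfolding cut_edges_def by auto
      then have "x \<in> C \<or> y \<in> C"
        using C xy(1) unfolding cut_cover_def by auto
      then show ?thesis
        using d xy False unfolding D'_def by auto
    qed
  qed
  then have D': "cut_cover G ?Q D'"
    using CV DV unfolding cut_cover_def D'_def by blast
  have leC: "cover_weight G P C \<le> cover_weight G P C'"
    unfolding C_def by (rule least_cover_le[OF G C'])
  have leD: "cover_weight G ?Q D \<le> cover_weight G ?Q D'"
    unfolding D_def by (rule least_cover_le[OF G D'])
  have split: "card X = card (X \<inter> P) + card (X - P)"
    "card (X - P) = card (X \<inter> {v}) + card (X - ?Q)" if "finite X" for X
  proof -
    show "card X = card (X \<inter> P) + card (X - P)"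
      using that card_Int_Diff by blast
    have "card (X - P) = card ((X - P) \<inter> {v}) + card (X - P - {v})"
      using that by (intro card_Int_Diff) auto
    moreover have "(X - P) \<inter> {v} = X \<inter> {v}" "X - P - {v} = X - ?Q"
      using v by auto
    ultimately show "card (X - P) = card (X \<inter> {v}) + card (X - ?Q)" by simp
  qed
  \<comment> \<open>In passing from \<open>C\<close> to \<open>C'\<close>, \<open>p\<close> vertices
    are gained on \<open>P\<close> and \<open>q\<close> are lost outside \<open>?Q\<close>; from
    \<open>D\<close> to \<open>D'\<close>, \<open>p\<close> are lost and \<open>q\<close> gained in
    the same places.\<close>
  define p where "p = card (D \<inter> P - C)"
  define q where "q = card (C - ?Q - D)"
  have fin': "finite C'" "finite D'"
    unfolding C'_def D'_def using finC finD by auto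
  have v_parts: "C' \<inter> {v} = C \<inter> {v}" "D' \<inter> {v} = D \<inter> {v}"
    unfolding C'_def D'_def using v by auto
  have n1: "card (C' \<inter> P) = card (C \<inter> P) + p"
  proof -
    have "C' \<inter> P \<inter> C = C \<inter> P" "C' \<inter> P - C = D \<inter> P - C"
      unfolding C'_def using v by auto
    then show ?thesis
      unfolding p_def using card_Int_Diff[of "C' \<inter> P" C] fin' by simp
  qed
  have n2: "card (C - ?Q) = card (C' - ?Q) + q"
  proof -
    have "(C - ?Q) \<inter> D = C' - ?Q"
      unfolding C'_def using v by auto
    then show ?thesis
      unfolding q_def using card_Int_Diff[of "C - ?Q" D] finC by simp
  qed
  have n3: "card (D \<inter> P) = card (D' \<inter> P) + p"
  proof -
    have "D \<inter> P \<inter> C = D' \<inter> P"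
      unfolding D'_def using v by auto
    then show ?thesis
      unfolding p_def using card_Int_Diff[of "D \<inter> P" C] finD by simp
  qed
  have n4: "card (D' - ?Q) = card (D - ?Q) + q"
  proof -
    have "(D' - ?Q) \<inter> D = D - ?Q" "D' - ?Q - D = C - ?Q - D"
      unfolding D'_def using v by auto
    then show ?thesis
      unfolding q_def using card_Int_Diff[of "D' - ?Q" D] fin' by simp
  qed
  \<comment> \<open>The term for vertices outside the cut contributes the extra \<open>q\<close> to
    both inequalities. Together they force equality, so \<open>Suc ?n\<close> divides
    \<open>q\<close>; as \<open>q\<close> is at most \<open>?n\<close>, both \<open>q\<close> and
    \<open>p\<close> vanish. Minimum size alone would only give \<open>p = q\<close>.\<close>
  have "Suc ?n * q + q \<le> Suc ?n * p"
    using leC unfolding cover_weight_def split[OF finC] split[OF fin'(1)] v_parts n1 n2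
    by (simp add: algebra_simps)
  moreover have "Suc ?n * p \<le> Suc ?n * q + q"
    using leD unfolding cover_weight_def split[OF finD] split[OF fin'(2)] v_parts n3 n4
    by (simp add: algebra_simps)
  ultimately have pq: "Suc ?n * p = Suc ?n * q + q"
    by simp
  then have "Suc ?n dvd q"
    by (metis dvd_add_right_iff dvd_triv_left)
  moreover have "q \<le> ?n"
    unfolding q_def using CV fin by (intro card_mono) auto
  ultimately have "q = 0"
    by (meson dvd_imp_le le_imp_less_Suc not_le zero_less_iff_neq_zero)
  with pq have "p = 0" by simp
  with \<open>q = 0\<close> have "C - ?Q - D = {}" "D \<inter> P - C = {}"
    unfolding p_def q_def using finC finD by auto
  then show "least_cover G P - insert v P \<subseteq> least_cover G (insert v P)"
    and "least_cover G (insert v P) \<inter> P \<subseteq> least_cover G P"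
    unfolding C_def D_def by auto
qed

text \<open>Each bag consists of one vertex and the least covers of the cuts just before and just
  after it, hence of at most \<open>2 * m + 1\<close> vertices. Nestedness of the covers makes the
  bags containing a given vertex consecutive.\<close>

lemma pathwidth_le_if_small_cuts:
  assumes G: "finite_simple_graph G"
    and vs: "set vs = verts G" "distinct vs"
    and small: "\<And>i. i \<le> length vs \<Longrightarrow> coverable (cut_edges (edges G) (set (take i vs))) m"
  shows "pathwidth G \<le> int (2 * m)"
\<comment> \<open>Without vertices the construction would give the empty list of bags, which is not
  a path-decomposition; a single empty bag is used instead.\<close>
proof (cases "vs = []")
  case True
  then have "verts G = {}"
    using vs by simp
  moreover have "path_decomposition G [verts G]"
    using G unfolding path_decomposition_def finite_simple_graph_def by auto
  then have "pathwidth G \<le> decomposition_width [verts G]"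
    by (rule pathwidth_attained(2)[OF G])
  ultimately have "pathwidth G \<le> -1"
    unfolding decomposition_width_def by simp
  also have "\<dots> \<le> int (2 * m)"
    by simp
  finally show ?thesis .
next
  case False
  let ?n = "length vs"
  have fin: "finite (verts G)"
    using G unfolding finite_simple_graph_def by blast
  define C where "C i = least_cover G (set (take i vs))" for i
  define bag where "bag i = insert (vs ! i) (C i \<union> C (Suc i))" for i
  define Bs where "Bs = map bag [0..<?n]"
  have CV: "C i \<subseteq> verts G" for i
    using least_cover[OF G] unfolding C_def cut_cover_def by auto
  have in_take: "vs ! p \<in> set (take i vs) \<longleftrightarrow> p < i" if "p < ?n" for p i
    using that vs(2) by (auto simp: in_set_conv_nth nth_eq_iff_index_eq)
  have step: "C i - set (take (Suc i) vs) \<subseteq> C (Suc i)" "C (Suc i) \<inter> set (take i vs) \<subseteq> C i"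
    if "i < ?n" for i
  proof -
    have eq: "set (take (Suc i) vs) = insert (vs ! i) (set (take i vs))"
      using that by (simp add: take_Suc_conv_app_nth)
    have "vs ! i \<in> verts G" "vs ! i \<notin> set (take i vs)" "set (take i vs) \<subseteq> verts G"
      using that vs in_take by (auto dest: in_set_takeD)
    from least_cover_nested[OF G this]
    show "C i - set (take (Suc i) vs) \<subseteq> C (Suc i)" "C (Suc i) \<inter> set (take i vs) \<subseteq> C i"
      unfolding C_def eq by auto
  qed
  \<comment> \<open>Cut \<open>j\<close> comes after the first \<open>j\<close> vertices. A vertex
    in a cover persists to the right until its own position is reached (\<open>right\<close>) and,
    once passed, to the left back to the cut just after it (\<open>left\<close>).\<close>
  have right: "vs ! p \<in> C j" if "i \<le> j" "j \<le> p" "p < ?n" "vs ! p \<in> C i" for i j p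
    using that
  proof (induction rule: dec_induct)
    case (step j)
    then show ?case
      using \<open>\<And>i. i < ?n \<Longrightarrow> C i - set (take (Suc i) vs) \<subseteq> C (Suc i)\<close>[of j] in_take[of p "Suc j"]
      by auto
  qed simp
  have left: "vs ! p \<in> C j" if "j \<le> i" "p < j" "i \<le> ?n" "vs ! p \<in> C i" for i j p
    using that
  proof (induction rule: inc_induct)
    case (step j)
    then show ?case
      using \<open>\<And>i. i < ?n \<Longrightarrow> C (Suc i) \<inter> set (take i vs) \<subseteq> C i\<close>[of j] in_take[of p j]
      by auto
  qed simp
  have cover: "vs ! p \<in> C i \<or> vs ! q \<in> C i"
    if "{vs ! p, vs ! q} \<in> edges G" "p < i" "i \<le> q" "q < ?n" for p q i
  proof -
    have "{vs ! p, vs ! q} \<in> cut_edges (edges G) (set (take i vs))"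
      using that in_take[of p i] in_take[of q i] unfolding cut_edges_def by auto
    then show ?thesis
      using least_cover[OF G, of "set (take i vs)"] unfolding cut_cover_def C_def by auto
  qed
  \<comment> \<open>The edge crosses every cut from \<open>Suc p\<close> to \<open>q\<close>, so
    each of these covers contains one of its ends. Follow \<open>vs ! p\<close> through them: if it
    is missing at once, bag \<open>p\<close> works; if it survives to cut \<open>q\<close>, bag
    \<open>q\<close> works; if it drops out between cuts \<open>i\<close> and \<open>Suc i\<close>,
    then \<open>vs ! q\<close> lies in the latter cover and bag \<open>i\<close> contains
    both.\<close>
  have edge_bag: "\<exists>i<?n. {vs ! p, vs ! q} \<subseteq> bag i"
    if e: "{vs ! p, vs ! q} \<in> edges G" and pq: "p < q" "q < ?n" for p q
  proof (cases "vs ! p \<in> C (Suc p)")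
    case False
    then have "{vs ! p, vs ! q} \<subseteq> bag p"
      using cover[OF e, of "Suc p"] pq unfolding bag_def by auto
    then show ?thesis using pq by (intro exI[of _ p]) auto
  next
    case p: True
    show ?thesis
    proof (cases "vs ! p \<in> C q")
      case True
      then show ?thesis
        using pq unfolding bag_def by (intro exI[of _ q]) auto
    next
      case False
      have "\<exists>i. p < i \<and> i < q \<and> vs ! p \<in> C i \<and> vs ! p \<notin> C (Suc i)"
      proof (rule ccontr)
        assume no: "\<not> ?thesis"
        have "Suc p \<le> q" using pq by simp
        then have "vs ! p \<in> C q"
        proof (induction rule: dec_induct)
          case base
          show ?case by (rule p)
        next
          case (step i)
          then show ?case using no by auto
        qed
        with False show False ..
      qed
      then obtain i where i: "p < i" "i < q" "vs ! p \<in> C i" "vs ! p \<notin> C (Suc i)"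
        by blast
      then have "{vs ! p, vs ! q} \<subseteq> bag i"
        using cover[OF e, of "Suc i"] pq unfolding bag_def by auto
      then show ?thesis using i pq by (intro exI[of _ i]) auto
    qed
  qed
  have "path_decomposition G Bs"
    unfolding path_decomposition_def
  proof (intro conjI ballI allI impI)
    show "Bs \<noteq> []"
      using False unfolding Bs_def by simp
    have "verts G \<subseteq> \<Union>(set Bs)"
    proof
      fix x assume "x \<in> verts G"
      then obtain i where "i < ?n" "x = vs ! i"
        using vs(1) by (metis in_set_conv_nth)
      then show "x \<in> \<Union>(set Bs)"
        unfolding Bs_def bag_def by auto
    qed
    moreover have "\<Union>(set Bs) \<subseteq> verts G"
      using CV vs(1) unfolding Bs_def bag_def by fastforce
    ultimately show "\<Union>(set Bs) = verts G" by simp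
  next
    fix e assume e: "e \<in> edges G"
    then have "card e = 2" "e \<subseteq> verts G"
      using G unfolding finite_simple_graph_def by auto
    then obtain x y where xy: "e = {x, y}" "x \<noteq> y" "x \<in> set vs" "y \<in> set vs"
      using vs(1) by (auto simp: card_2_iff)
    then obtain p q where pq: "x = vs ! p" "y = vs ! q" "p < ?n" "q < ?n"
      by (metis in_set_conv_nth)
    then have "p < q \<or> q < p"
      using xy(2) by (metis linorder_neqE_nat)
    then obtain i where "i < ?n" "e \<subseteq> bag i"
      using edge_bag[of p q] edge_bag[of q p] e xy(1) pq by (metis insert_commute)
    then show "\<exists>X\<in>set Bs. e \<subseteq> X"
      unfolding Bs_def by auto
  next
    fix i j k assume ijk: "i < j \<and> j < k \<and> k < length Bs"
    then have len: "k < ?n" unfolding Bs_def by simp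
    show "Bs ! i \<inter> Bs ! k \<subseteq> Bs ! j"
    proof
      fix x assume "x \<in> Bs ! i \<inter> Bs ! k"
      then have x: "x \<in> bag i" "x \<in> bag k"
        using ijk len unfolding Bs_def by auto
      then have "x \<in> verts G"
        using CV[of i] CV[of "Suc i"] vs(1) ijk len unfolding bag_def by auto
      then obtain p where p: "x = vs ! p" "p < ?n"
        using vs(1) by (metis in_set_conv_nth)
      have "x \<in> bag j"
      \<comment> \<open>Left of its own position the vertex is carried from bag \<open>i\<close>
        rightwards to \<open>j\<close>, right of it from bag \<open>k\<close> leftwards.\<close>
      proof (cases j p rule: linorder_cases)
        case equal
        then show ?thesis using p unfolding bag_def by simp
      next
        case less
        then have "vs ! p \<noteq> vs ! i"
          using vs(2) p ijk len by (simp add: nth_eq_iff_index_eq)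
        then have "vs ! p \<in> C i \<or> vs ! p \<in> C (Suc i)"
          using x p unfolding bag_def by auto
        then have "vs ! p \<in> C j"
          using right[of i j p] right[of "Suc i" j p] less p ijk by auto
        then show ?thesis using p unfolding bag_def by simp
      next
        case greater
        then have "vs ! p \<noteq> vs ! k"
          using vs(2) p ijk len by (simp add: nth_eq_iff_index_eq)
        then have "vs ! p \<in> C k \<or> vs ! p \<in> C (Suc k)"
          using x p unfolding bag_def by auto
        then have "vs ! p \<in> C (Suc j)"
          using left[of "Suc j" k p] left[of "Suc j" "Suc k" p] greater p ijk len by auto
        then show ?thesis using p unfolding bag_def by simp
      qed
      then show "x \<in> Bs ! j"
        using ijk len unfolding Bs_def by simp
    qed
  qed
  then have "pathwidth G \<le> decomposition_width Bs"
    by (rule pathwidth_attained(2)[OF G])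
  also have "\<dots> \<le> int (2 * m)"
  proof -
    have "card X \<le> 2 * m + 1" if X: "X \<in> set Bs" for X
    proof -
      obtain i where i: "i < ?n" "X = bag i"
        using X unfolding Bs_def by auto
      have "card (C i) \<le> m" "card (C (Suc i)) \<le> m"
        unfolding C_def using i small by (auto intro!: card_least_cover[OF G])
      moreover have "card (C i \<union> C (Suc i)) \<le> card (C i) + card (C (Suc i))"
        by (rule card_Un_le)
      moreover have "card X \<le> Suc (card (C i \<union> C (Suc i)))"
        unfolding i bag_def by (rule card_insert_le_m1) auto
      ultimately show ?thesis by linarith
    qed
    then have "Max (card ` set Bs) \<le> 2 * m + 1"
      using False unfolding Bs_def by (subst Max_le_iff) auto
    then show ?thesis
      unfolding decomposition_width_def by linarith
  qed
  finally show ?thesis .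
qed

section \<open>Sweeping a drawing\<close>

lemma finite_linear_order_rank:
  assumes "finite X" "linear_order_on X r"
  shows "\<exists>g::'a \<Rightarrow> nat. \<forall>x\<in>X. \<forall>y\<in>X. before r x y \<longleftrightarrow> g x < g y"
proof -
  have tr: "trans r" and an: "antisym r" and tot: "total_on X r"
    using assms(2)
    unfolding linear_order_on_def partial_order_on_def preorder_on_def by auto
  define g where "g x = card {z \<in> X. before r z x}" for x
  have mono: "g x < g y" if "x \<in> X" "before r x y" for x y
  proof -
    have "{z \<in> X. before r z x} \<subset> {z \<in> X. before r z y}"
      using that tr an unfolding before_def psubset_eq
      by (auto dest: transD antisymD)
    then show ?thesis
      unfolding g_def using assms(1) by (intro psubset_card_mono) auto
  qed
  have "before r x y \<longleftrightarrow> g x < g y" if "x \<in> X" "y \<in> X" for x y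
    using mono[of x y] mono[of y x] that tot unfolding before_def total_on_def
    by (metis less_asym less_irrefl)
  then show ?thesis by blast
qed

lemma vertex_order_of_extensions:
  assumes "finite V" and "good {}"
    and ext: "\<And>P. P \<subset> V \<Longrightarrow> good P \<Longrightarrow> \<exists>v\<in>V - P. good (insert v P)"
  shows "\<exists>vs. set vs = V \<and> distinct vs \<and> (\<forall>i\<le>length vs. good (set (take i vs)))"
proof -
  have "\<exists>vs. set vs \<subseteq> V \<and> distinct vs \<and> length vs = n \<and> (\<forall>i\<le>n. good (set (take i vs)))"
    if "n \<le> card V" for n
    using that
  proof (induction n)
    case 0
    then show ?case using assms(2) by auto
  next
    case (Suc n)
    then obtain vs where vs: "set vs \<subseteq> V" "distinct vs" "length vs = n"
      "\<forall>i\<le>n. good (set (take i vs))"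
      by auto
    have "set vs \<noteq> V"
      using vs Suc.prems distinct_card[of vs] by auto
    then obtain v where v: "v \<in> V - set vs" "good (insert v (set vs))"
      using ext[of "set vs"] vs by (metis order_refl psubsetI take_all_iff)
    have "good (set (take i (vs @ [v])))" if "i \<le> Suc n" for i
      using that vs v by (cases "i = Suc n") auto
    then show ?case
      using vs v by (intro exI[of _ "vs @ [v]"]) auto
  qed
  from this[of "card V"] obtain vs where vs: "set vs \<subseteq> V" "distinct vs"
    "length vs = card V" "\<forall>i\<le>card V. good (set (take i vs))"
    by auto
  then have "set vs = V"
    using assms(1) by (intro card_subset_eq) (auto simp: distinct_card)
  then show ?thesis using vs by auto
qed

text \<open>For the two sides of a drawing, taken in both orders as \<open>X\<close> and
  \<open>Y\<close>, these sets together make up the edges across the cut \<open>P\<close>, separated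
  by the line on which the end inside \<open>P\<close> lies.\<close>

definition edges_leaving :: "'a set set \<Rightarrow> 'a set \<Rightarrow> 'a set \<Rightarrow> 'a set \<Rightarrow> 'a set set" where
  "edges_leaving E X Y P = {e \<in> E. \<exists>x\<in>X \<inter> P. \<exists>y\<in>Y - P. e = {x, y}}"

definition initial_part :: "'a set \<Rightarrow> ('a \<Rightarrow> nat) \<Rightarrow> 'a set \<Rightarrow> bool" where
  "initial_part X g P \<longleftrightarrow> (\<forall>x\<in>X \<inter> P. \<forall>y\<in>X. g y < g x \<longrightarrow> y \<in> P)"

lemma initial_part_extend:
  assumes "finite X" "\<not> X \<subseteq> P" "initial_part X g P"
  shows "\<exists>x\<in>X - P. initial_part X g (insert x P)"
proof -
  obtain x where x: "x \<in> X - P" "\<forall>y\<in>X - P. g x \<le> g y"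
    using ex_has_least_nat[of "\<lambda>x. x \<in> X - P" _ g] assms(2) by blast
  then show ?thesis
    using assms(3) unfolding initial_part_def by (metis DiffI IntE IntI insert_iff leD)
qed

text \<open>Every edge that newly leaves on the side of \<open>X\<close> contains the added vertex,
  which costs one cover vertex. On the side of \<open>Y\<close> no edge is added. This is why only
  the first family needs slack.\<close>

lemma sweep_step:
  assumes fin: "finite X" and XY: "X \<inter> Y = {}"
    and ext: "\<not> X \<subseteq> P" and init: "initial_part X g P" "initial_part Y h P"
    and cov: "coverable (edges_leaving E X Y P) n" "coverable (edges_leaving E Y X P) (Suc n)"
  shows "\<exists>x\<in>X - P. initial_part X g (insert x P) \<and> initial_part Y h (insert x P) \<and>
    coverable (edges_leaving E X Y (insert x P)) (Suc n) \<and>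
    coverable (edges_leaving E Y X (insert x P)) (Suc n)"
proof -
  obtain x where x: "x \<in> X - P" "initial_part X g (insert x P)"
    using initial_part_extend[OF fin ext init(1)] by blast
  have "initial_part Y h (insert x P)"
    using x(1) XY init(2) unfolding initial_part_def by blast
  moreover have "coverable (edges_leaving E X Y (insert x P)) (Suc n)"
    using cov(1) by (rule coverable_insert_vertex[of _ _ _ x]) (auto simp: edges_leaving_def)
  moreover have "coverable (edges_leaving E Y X (insert x P)) (Suc n)"
    using cov(2)
    by (rule coverable_mono) (use x(1) XY in \<open>auto simp: edges_leaving_def\<close>)
  ultimately show ?thesis using x by blast
qed

lemma crosses_sym: "crosses D e f \<longleftrightarrow> crosses D f e"
proof -
  have "crosses D f e" if c: "crosses D e f" for e f
  proof -
    obtain v w x y where vw: "v \<in> side_A D" "w \<in> side_B D" "x \<in> side_A D" "y \<in> side_B D"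
      "e = {v, w}" "f = {x, y}"
      "before (order_A D) v x \<and> before (order_B D) y w \<or>
       before (order_A D) x v \<and> before (order_B D) w y"
      using c unfolding crosses_def by (elim bexE conjE) (rule that; assumption)
    show ?thesis
      unfolding crosses_def
      by (rule bexI[of _ x], rule bexI[of _ y], rule bexI[of _ v], rule bexI[of _ w]) (use vw in auto)
  qed
  then show ?thesis by blast
qed

text \<open>Disjointness of the sides determines which end of an edge lies on which line, and this
  resolves the existential quantifiers in \<open>crosses\<close>.\<close>

lemma crosses_iff:
  assumes "side_A D \<inter> side_B D = {}"
    and "a \<in> side_A D" "b \<in> side_B D" "x \<in> side_A D" "y \<in> side_B D"
  shows "crosses D {a, b} {x, y} \<longleftrightarrow>
    before (order_A D) a x \<and> before (order_B D) y b \<or>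
    before (order_A D) x a \<and> before (order_B D) b y"
proof -
  have "{a, b} = {v, w} \<longleftrightarrow> v = a \<and> w = b" if "v \<in> side_A D" "w \<in> side_B D" for v w
    using assms that by (auto simp: doubleton_eq_iff)
  moreover have "{x, y} = {v, w} \<longleftrightarrow> v = x \<and> w = y" if "v \<in> side_A D" "w \<in> side_B D" for v w
    using assms that by (auto simp: doubleton_eq_iff)
  ultimately show ?thesis
    unfolding crosses_def using assms by metis
qed

text \<open>The two families of edges across a cut cross each other completely, so one of them has a
  cover of size \<open>n\<close>; the cut advances on the line of that family. Each cut then has a
  cover of size \<open>2 * Suc n\<close>, and the resulting decomposition doubles this once
  more.\<close>

lemma pathwidth_le_if_opposite_cuts:
  assumes G: "finite_simple_graph G" and D: "two_layer_drawing G D"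
    and opp: "\<And>E F. E \<subseteq> edges G \<Longrightarrow> F \<subseteq> edges G \<Longrightarrow> \<forall>e\<in>E. \<forall>f\<in>F. crosses D e f \<Longrightarrow>
      coverable E n \<or> coverable F n"
  shows "pathwidth G \<le> int (4 * Suc n)"
proof -
  let ?A = "side_A D" and ?B = "side_B D"
  let ?E = "edges G" and ?V = "verts G"
  have fin: "finite ?V"
    using G unfolding finite_simple_graph_def by blast
  have bip: "?A \<union> ?B = ?V" "?A \<inter> ?B = {}" "\<forall>e\<in>?E. \<exists>a\<in>?A. \<exists>b\<in>?B. e = {a, b}"
    using D unfolding two_layer_drawing_def bipartition_def by auto
  have finAB: "finite ?A" "finite ?B"
    using bip(1) fin by (metis finite_Un)+
  obtain g where g: "\<forall>x\<in>?A. \<forall>y\<in>?A. before (order_A D) x y \<longleftrightarrow> g x < (g y :: nat)"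
    using finite_linear_order_rank[OF finAB(1)] D unfolding two_layer_drawing_def by blast
  obtain h where h: "\<forall>x\<in>?B. \<forall>y\<in>?B. before (order_B D) x y \<longleftrightarrow> h x < (h y :: nat)"
    using finite_linear_order_rank[OF finAB(2)] D unfolding two_layer_drawing_def by blast
  have total: "before r x y \<or> before r y x"
    if "linear_order_on X r" "x \<in> X" "y \<in> X" "x \<noteq> y" for X x y and r :: "'a rel"
    using that unfolding before_def linear_order_on_def total_on_def by auto
  have first_A: "before (order_A D) x y" if "initial_part ?A g P" "x \<in> ?A \<inter> P" "y \<in> ?A - P" for x y P
    using total[of ?A "order_A D" x y] D g that
    unfolding two_layer_drawing_def initial_part_def by blast
  have first_B: "before (order_B D) x y" if "initial_part ?B h P" "x \<in> ?B \<inter> P" "y \<in> ?B - P" for x y P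
    using total[of ?B "order_B D" x y] D h that
    unfolding two_layer_drawing_def initial_part_def by blast
  \<comment> \<open>The invariant allows \<open>Suc n\<close> on both sides, whereas
    \<open>opp\<close> supplies \<open>n\<close> on one of them: this difference pays for the next
    vertex.\<close>
  define good where "good P \<longleftrightarrow> initial_part ?A g P \<and> initial_part ?B h P \<and>
    coverable (edges_leaving ?E ?A ?B P) (Suc n) \<and> coverable (edges_leaving ?E ?B ?A P) (Suc n)" for P
  have "good {}"
    unfolding good_def initial_part_def edges_leaving_def by (simp add: coverable_empty)
  moreover have "\<exists>v\<in>?V - P. good (insert v P)" if P: "P \<subset> ?V" "good P" for P
  proof -
    let ?E1 = "edges_leaving ?E ?A ?B P" and ?E2 = "edges_leaving ?E ?B ?A P"
    have init: "initial_part ?A g P" "initial_part ?B h P"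
      using P(2) unfolding good_def by auto
    have "crosses D e f" if ef: "e \<in> ?E1" "f \<in> ?E2" for e f
    proof -
      obtain a b where ab: "e = {a, b}" "a \<in> ?A \<inter> P" "b \<in> ?B - P"
        using ef(1) unfolding edges_leaving_def by blast
      obtain x y where xy: "f = {y, x}" "y \<in> ?B \<inter> P" "x \<in> ?A - P"
        using ef(2) unfolding edges_leaving_def by blast
      show ?thesis
        unfolding crosses_def
        using ab xy first_A[OF init(1) ab(2) xy(3)] first_B[OF init(2) xy(2) ab(3)]
        by (auto simp: insert_commute)
    qed
    then have "coverable ?E1 n \<or> coverable ?E2 n"
      by (intro opp) (auto simp: edges_leaving_def)
    \<comment> \<open>If one line is exhausted, no edge can end on it outside \<open>P\<close>, so
      the family leaving the other line is empty and the sweep can continue there.\<close>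
    moreover have "coverable ?E2 n" if "?A \<subseteq> P"
    proof -
      have "?E2 = {}"
        using that unfolding edges_leaving_def by blast
      then show ?thesis by (simp add: coverable_empty)
    qed
    moreover have "coverable ?E1 n" if "?B \<subseteq> P"
    proof -
      have "?E1 = {}"
        using that unfolding edges_leaving_def by blast
      then show ?thesis by (simp add: coverable_empty)
    qed
    moreover have "\<not> (?A \<subseteq> P \<and> ?B \<subseteq> P)"
      using P(1) bip(1) by blast
    ultimately consider "\<not> ?A \<subseteq> P" "coverable ?E1 n" | "\<not> ?B \<subseteq> P" "coverable ?E2 n"
      by blast
    then show ?thesis
    proof cases
      case 1
      then show ?thesis
        using sweep_step[OF finAB(1) bip(2) 1(1) init 1(2)] P(2) bip(1) unfolding good_def by blast
    next
      case 2
      have "?B \<inter> ?A = {}" using bip(2) by blast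
      then show ?thesis
        using sweep_step[OF finAB(2) _ 2(1) init(2,1) 2(2)] P(2) bip(1) unfolding good_def by blast
    qed
  qed
  ultimately obtain vs where vs: "set vs = ?V" "distinct vs"
    "\<forall>i\<le>length vs. good (set (take i vs))"
    using vertex_order_of_extensions[OF fin, of good] by blast
  have "coverable (cut_edges ?E P) (2 * Suc n)" if "good P" for P
  proof -
    have "coverable (edges_leaving ?E ?A ?B P \<union> edges_leaving ?E ?B ?A P) (Suc n + Suc n)"
      using that unfolding good_def by (intro coverable_Un) auto
    moreover have "cut_edges ?E P \<subseteq> edges_leaving ?E ?A ?B P \<union> edges_leaving ?E ?B ?A P"
    proof
      fix e assume e: "e \<in> cut_edges ?E P"
      then obtain a b where "a \<in> ?A" "b \<in> ?B" "e = {a, b}"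
        using bip(3) unfolding cut_edges_def by blast
      with e show "e \<in> edges_leaving ?E ?A ?B P \<union> edges_leaving ?E ?B ?A P"
        unfolding cut_edges_def edges_leaving_def by blast
    qed
    ultimately show ?thesis
      by (rule coverable_mono) simp
  qed
  then have "pathwidth G \<le> int (2 * (2 * Suc n))"
    using vs by (intro pathwidth_le_if_small_cuts[OF G vs(1,2)]) auto
  then show ?thesis by simp
qed

text \<open>Ramsey's theorem for the graph on \<open>M\<close> that joins crossing edges: a clique
  of size \<open>k\<close> would be a \<open>k\<close>-crossing, so there is an independent set of
  size \<open>s\<close>. The number \<open>r\<close> depends only on \<open>k\<close> and
  \<open>s\<close>, and so serves all graphs and drawings at once.\<close>

lemma non_crossing_submatching:
  "\<exists>r. \<forall>(G :: 'a graph) D M. two_layer_drawing G D \<longrightarrow> k_matching G r M \<longrightarrow>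
    (\<nexists>K. k_crossing G D k K) \<longrightarrow> (\<exists>S\<subseteq>M. k_matching G s S \<and> non_crossing D S)"
proof -
  obtain r where r: "\<forall>(V :: 'a set set) E. finite V \<and> card V \<ge> r \<longrightarrow>
    (\<exists>R \<subseteq> V. card R = k \<and> clique R E \<or> card R = s \<and> indep R E)"
    using ramsey2[of k s, where ?'a = "'a set"] by blast
  have "\<exists>S\<subseteq>M. k_matching G s S \<and> non_crossing D S"
    if D: "two_layer_drawing G D" and M: "k_matching G r M" and no: "\<nexists>K. k_crossing G D k K"
    for G :: "'a graph" and D M
  proof -
    define X where "X = {{e, f} | e f. crosses D e f}"
    have X: "{e, f} \<in> X \<longleftrightarrow> crosses D e f" for e f
      unfolding X_def using crosses_sym[of D e f] by (auto simp: doubleton_eq_iff)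
    have fin: "finite M" "M \<subseteq> edges G"
      using M unfolding k_matching_def by auto
    obtain R where R: "R \<subseteq> M" "card R = k \<and> clique R X \<or> card R = s \<and> indep R X"
      using r[rule_format, of M X] M unfolding k_matching_def by blast
    have finR: "finite R"
      using R(1) fin(1) finite_subset by blast
    have "\<not> (card R = k \<and> clique R X)"
    proof
      assume "card R = k \<and> clique R X"
      then have "pairwise (crosses D) R"
        using X unfolding clique_def pairwise_def by simp
      then have "k_crossing G D k R"
        using R(1) fin(2) finR \<open>card R = k \<and> clique R X\<close> unfolding k_crossing_def by blast
      with no show False by blast
    qed
    then have s: "card R = s" "indep R X"
      using R(2) by auto
    have AB: "side_A D \<inter> side_B D = {}"
      using D unfolding two_layer_drawing_def bipartition_def by blast
    \<comment> \<open>\<open>indep\<close> constrains only distinct edges, while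
      \<open>non_crossing\<close> also compares an edge with itself.\<close>
    have "\<not> crosses D e e" for e
    proof
      assume "crosses D e e"
      then obtain v w x y where "v \<in> side_A D" "w \<in> side_B D" "x \<in> side_A D" "y \<in> side_B D"
        "{v, w} = {x, y}" "before (order_A D) v x \<or> before (order_A D) x v"
        unfolding crosses_def by blast
      then show False
        using AB unfolding before_def by (auto simp: doubleton_eq_iff)
    qed
    then have "\<not> crosses D e f" if "e \<in> R" "f \<in> R" for e f
      using that s(2) X unfolding indep_def by (cases "e = f") auto
    then have "non_crossing D R"
      unfolding non_crossing_def by blast
    moreover have "k_matching G s R"
      using M R(1) finR s(1) unfolding k_matching_def by (meson pairwise_subset subset_trans)
    ultimately show ?thesis using R(1) by blast
  qed
  then show ?thesis by blast
qed

text \<open>Two completely crossing edge sets that both lack small covers contain large matchings;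
  thinned out to non-crossing ones, these would form an (s,t)-crossing.\<close>

lemma pathwidth_bounded_if_drawing:
  "\<exists>c. \<forall>(G :: 'a graph) D. finite_simple_graph G \<longrightarrow> two_layer_drawing G D \<longrightarrow>
    (\<nexists>M. k_crossing G D k M) \<longrightarrow> (\<nexists>S T. st_crossing G D s t S T) \<longrightarrow> pathwidth G \<le> c"
proof -
  obtain r1 where r1: "\<And>(G :: 'a graph) D M. two_layer_drawing G D \<Longrightarrow> k_matching G r1 M \<Longrightarrow>
    (\<nexists>K. k_crossing G D k K) \<Longrightarrow> \<exists>S\<subseteq>M. k_matching G s S \<and> non_crossing D S"
    using non_crossing_submatching[of k s] by blast
  obtain r2 where r2: "\<And>(G :: 'a graph) D M. two_layer_drawing G D \<Longrightarrow> k_matching G r2 M \<Longrightarrow>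
    (\<nexists>K. k_crossing G D k K) \<Longrightarrow> \<exists>S\<subseteq>M. k_matching G t S \<and> non_crossing D S"
    using non_crossing_submatching[of k t] by blast
  define n where "n = 2 * max r1 r2"
  have "pathwidth G \<le> int (4 * Suc n)"
    if G: "finite_simple_graph G" and D: "two_layer_drawing G D"
      and k: "\<nexists>M. k_crossing G D k M" and st: "\<nexists>S T. st_crossing G D s t S T"
    for G :: "'a graph" and D
  proof (rule pathwidth_le_if_opposite_cuts[OF G D], rule ccontr)
    fix E F assume EF: "E \<subseteq> edges G" "F \<subseteq> edges G" "\<forall>e\<in>E. \<forall>f\<in>F. crosses D e f"
    assume "\<not> (coverable E n \<or> coverable F n)"
    then have nc: "\<not> coverable E (2 * r1)" "\<not> coverable F (2 * r2)"
      unfolding n_def by (meson coverable_mono order_refl max.cobounded1 max.cobounded2 mult_le_mono2)+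
    have card2: "\<And>e. e \<in> E \<Longrightarrow> card e = 2" "\<And>e. e \<in> F \<Longrightarrow> card e = 2"
      using EF G unfolding finite_simple_graph_def by auto
    obtain M where M: "M \<subseteq> E" "k_matching G r1 M"
      using matching_if_not_coverable[OF nc(1) card2(1)] EF unfolding k_matching_def by blast
    obtain N where N: "N \<subseteq> F" "k_matching G r2 N"
      using matching_if_not_coverable[OF nc(2) card2(2)] EF unfolding k_matching_def by blast
    obtain S where S: "S \<subseteq> M" "k_matching G s S" "non_crossing D S"
      using r1[OF D M(2) k] by blast
    obtain T where T: "T \<subseteq> N" "k_matching G t T" "non_crossing D T"
      using r2[OF D N(2) k] by blast
    have "st_crossing G D s t S T"
      using S T M(1) N(1) EF(3) unfolding st_crossing_def by blast
    with st show False by blast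
  qed
  then show ?thesis by blast
qed

section \<open>Drawings from path-decompositions\<close>

lemma linear_order_on_key:
  fixes g :: "'a \<Rightarrow> nat"
  assumes "inj_on g X"
  shows "linear_order_on X {(x, y). x \<in> X \<and> y \<in> X \<and> g x \<le> g y}"
  using assms
  unfolding linear_order_on_def partial_order_on_def preorder_on_def refl_on_def trans_def
    antisym_def total_on_def inj_on_def
  by auto

text \<open>Several vertices may share a first bag, while a drawing needs linear orders. Ties are
  broken by a numbering \<open>f\<close> below \<open>n\<close>, with the pair encoded
  lexicographically as \<open>l x * n + f x\<close>.\<close>

lemma injective_refinement:
  fixes l :: "'a \<Rightarrow> nat"
  assumes "finite V"
  shows "\<exists>g::'a \<Rightarrow> nat. inj_on g V \<and> (\<forall>x\<in>V. \<forall>y\<in>V. g x \<le> g y \<longrightarrow> l x \<le> l y)"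
proof -
  obtain f :: "'a \<Rightarrow> nat" and n where f: "f ` V = {i. i < n}" "inj_on f V"
    using finite_imp_inj_to_nat_seg[OF assms] by blast
  define g where "g x = l x * n + f x" for x
  have mono: "g x < g y" if "x \<in> V" "y \<in> V" "l x < l y" for x y
  proof -
    have "f x < n" using f(1) that(1) by blast
    then have "g x < Suc (l x) * n" unfolding g_def by simp
    also have "\<dots> \<le> l y * n" using that(3) by (intro mult_right_mono) auto
    finally show ?thesis unfolding g_def by simp
  qed
  have "inj_on g V"
  proof (rule inj_onI)
    fix x y assume xy: "x \<in> V" "y \<in> V" "g x = g y"
    then have "l x = l y"
      using mono[of x y] mono[of y x] by (cases "l x" "l y" rule: linorder_cases) auto
    then show "x = y"
      using xy f(2) unfolding g_def inj_on_def by auto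
  qed
  then show ?thesis
    using mono by (meson leD leI)
qed

text \<open>Here \<open>I\<close> is a set of pairwise crossing edges with ends \<open>a\<close> and \<open>b\<close>, and \<open>l\<close> is the
  first bag of a vertex. The bag where the leftmost \<open>b\<close>-end starts meets every edge whose
  \<open>a\<close>-end starts first.\<close>

lemma crossing_edges_common_bag:
  fixes l :: "'a \<Rightarrow> nat"
  assumes "finite I" "I \<noteq> {}"
    and cross: "\<And>e f. e \<in> I \<Longrightarrow> f \<in> I \<Longrightarrow> e \<noteq> f \<Longrightarrow>
      l (a e) \<le> l (a f) \<and> l (b f) \<le> l (b e) \<or> l (a f) \<le> l (a e) \<and> l (b e) \<le> l (b f)"
    and less: "\<And>e. e \<in> I \<Longrightarrow> l (a e) \<le> l (b e)"
  shows "\<exists>i. \<forall>e\<in>I. l (a e) \<le> i \<and> i \<le> l (b e)"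
proof -
  obtain m where m: "m \<in> I" "\<forall>e\<in>I. l (b m) \<le> l (b e)"
    using ex_has_least_nat[of "\<lambda>e. e \<in> I" _ "\<lambda>e. l (b e)"] assms(2) by blast
  \<comment> \<open>If \<open>e\<close> starts no later than \<open>m\<close> on the
    \<open>a\<close>-side, then \<open>l (a e)\<close> is at most \<open>l (a m)\<close>, hence at
    most \<open>l (b m)\<close>. Otherwise \<open>l (b e)\<close> is at most \<open>l (b m)\<close>,
    and \<open>less\<close> for \<open>e\<close> suffices.\<close>
  have "l (a e) \<le> l (b m) \<and> l (b m) \<le> l (b e)" if "e \<in> I" for e
    using cross[of e m] m less[of e] less[of m] that
    by (metis le_trans)
  then show ?thesis by blast
qed

text \<open>With both lines ordered by first bags, crossing edges have ends starting in opposite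
  orders. A large crossing therefore yields many edges whose ends start on either side of one index
  \<open>i\<close>, and the earlier ends of all of them lie in bag \<open>i\<close>.\<close>

lemma drawing_if_path_decomposition:
  assumes G: "finite_simple_graph G" and bip: "bipartite G"
    and Bs: "path_decomposition G Bs" and w: "\<And>X. X \<in> set Bs \<Longrightarrow> card X \<le> w"
  shows "\<exists>D. two_layer_drawing G D \<and> (\<nexists>M. k_crossing G D (2 * w + 1) M) \<and>
    (\<nexists>S T. st_crossing G D (w + 1) (w + 1) S T)"
proof -
  let ?V = "verts G"
  obtain A B where AB: "bipartition G A B"
    using bip unfolding bipartite_def by blast
  have fin: "finite ?V"
    using G unfolding finite_simple_graph_def by blast
  have AB_V: "A \<subseteq> ?V" "B \<subseteq> ?V" and disj: "A \<inter> B = {}"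
    using AB unfolding bipartition_def by auto
  define l where "l x = (LEAST i. i < length Bs \<and> x \<in> Bs ! i)" for x
  have l: "l x < length Bs \<and> x \<in> Bs ! l x" if "x \<in> ?V" for x
  proof -
    have "x \<in> \<Union>(set Bs)"
      using that Bs unfolding path_decomposition_def by auto
    then obtain i where "i < length Bs \<and> x \<in> Bs ! i"
      by (auto simp: in_set_conv_nth)
    then show ?thesis
      unfolding l_def by (rule LeastI)
  qed
  have l_le: "l x \<le> i" if "i < length Bs" "x \<in> Bs ! i" for x i
    unfolding l_def using that by (intro Least_le) auto
  obtain g :: "'a \<Rightarrow> nat" where g: "inj_on g ?V"
    and gl: "\<And>x y. x \<in> ?V \<Longrightarrow> y \<in> ?V \<Longrightarrow> g x \<le> g y \<Longrightarrow> l x \<le> l y"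
    using injective_refinement[OF fin, of l] by blast
  define D where "D = \<lparr>side_A = A, side_B = B,
    order_A = {(x, y). x \<in> A \<and> y \<in> A \<and> g x \<le> g y},
    order_B = {(x, y). x \<in> B \<and> y \<in> B \<and> g x \<le> g y}\<rparr>"
  have drawing: "two_layer_drawing G D"
    unfolding two_layer_drawing_def D_def
    using AB linear_order_on_key[of g A] linear_order_on_key[of g B] g AB_V
    by (auto intro: inj_on_subset)
  obtain a b where ab: "\<And>e. e \<in> edges G \<Longrightarrow> a e \<in> A \<and> b e \<in> B \<and> e = {a e, b e}"
    using AB unfolding bipartition_def by metis
  have abV: "a e \<in> ?V" "b e \<in> ?V" if "e \<in> edges G" for e
    using ab[OF that] AB_V by auto
  \<comment> \<open>\<open>lt\<close> records which of the two ways of crossing occurs: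
    \<open>e\<close> is left of \<open>f\<close> on the line of \<open>A\<close> and right of it on
    the line of \<open>B\<close>.\<close>
  define lt where "lt e f \<longleftrightarrow> g (a e) < g (a f) \<and> g (b f) < g (b e)" for e f
  have before_iff: "before {(x, y). x \<in> X \<and> y \<in> X \<and> g x \<le> g y} x y \<longleftrightarrow> g x < g y"
    if "X \<subseteq> ?V" "x \<in> X" "y \<in> X" for X x y
    using that g unfolding before_def inj_on_def by (auto simp: order_less_le)
  have crosses: "crosses D e f \<longleftrightarrow> lt e f \<or> lt f e" if "e \<in> edges G" "f \<in> edges G" for e f
  proof -
    have "crosses D {a e, b e} {a f, b f} \<longleftrightarrow> lt e f \<or> lt f e"
      unfolding lt_def using ab[OF that(1)] ab[OF that(2)] disj
      by (subst crosses_iff) (auto simp: D_def before_iff[OF AB_V(1)] before_iff[OF AB_V(2)])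
    then show ?thesis
      using ab[OF that(1)] ab[OF that(2)] by simp
  qed
  have ltl: "l (a e) \<le> l (a f) \<and> l (b f) \<le> l (b e)" if "lt e f" "e \<in> edges G" "f \<in> edges G" for e f
    using that abV gl unfolding lt_def by (meson less_imp_le)
  have edge_bag: "\<exists>X\<in>set Bs. e \<subseteq> X" if "e \<in> edges G" for e
    using Bs that unfolding path_decomposition_def by simp
  have interval: "Bs ! i \<inter> Bs ! k \<subseteq> Bs ! j" if "i < j" "j < k" "k < length Bs" for i j k
    using Bs that unfolding path_decomposition_def by simp
  have bags_V: "X \<subseteq> ?V" if "X \<in> set Bs" for X
    using Bs that unfolding path_decomposition_def by auto
  \<comment> \<open>The bag that \<open>x\<close> shares with \<open>y\<close> cannot come before
    \<open>l y\<close>, so \<open>x\<close> stays in all bags from \<open>l x\<close> up to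
    \<open>l y\<close>.\<close>
  have bag: "x \<in> Bs ! i" if xy: "{x, y} \<in> edges G" "x \<in> ?V" "l x \<le> i" "i \<le> l y" "y \<in> ?V" for x y i
  proof -
    obtain X where "X \<in> set Bs" "{x, y} \<subseteq> X"
      using edge_bag[OF xy(1)] by blast
    then obtain j where j: "j < length Bs" "x \<in> Bs ! j" "y \<in> Bs ! j"
      by (auto simp: in_set_conv_nth)
    have "i \<le> j" using l_le[OF j(1,3)] that(4) by simp
    then consider "i = l x" | "i = j" | "l x < i" "i < j"
      using xy(3) by linarith
    then show ?thesis
    proof cases
      case 3
      then have "Bs ! l x \<inter> Bs ! j \<subseteq> Bs ! i"
        using interval j(1) by simp
      then show ?thesis using l[OF that(2)] j by blast
    qed (use l that j in auto)
  qed
  have bound: "card I \<le> w"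
    if I: "inj_on p I" "\<And>e. e \<in> I \<Longrightarrow> {p e, q e} \<in> edges G \<and> p e \<in> ?V \<and> q e \<in> ?V"
      and i: "\<And>e. e \<in> I \<Longrightarrow> l (p e) \<le> i \<and> i \<le> l (q e)"
    for I i and p q :: "'a set \<Rightarrow> 'a"
  proof (cases "I = {}")
    case False
    then obtain e where "e \<in> I" by blast
    then have "i < length Bs"
      using l[of "q e"] I(2) i by fastforce
    then have X: "Bs ! i \<in> set Bs" by simp
    have "p ` I \<subseteq> Bs ! i"
      using bag I(2) i by blast
    moreover have "finite (Bs ! i)"
      using bags_V[OF X] fin finite_subset by blast
    ultimately have "card I \<le> card (Bs ! i)"
      using I(1) card_inj_on_le by blast
    then show ?thesis using w[OF X] by simp
  qed simp
  have bound_a: "card I \<le> w"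
    if "I \<subseteq> edges G" "inj_on a I" "\<And>e. e \<in> I \<Longrightarrow> l (a e) \<le> i \<and> i \<le> l (b e)" for I i
    by (rule bound[of a I b i]) (use that ab abV in auto)
  have bound_b: "card I \<le> w"
    if "I \<subseteq> edges G" "inj_on b I" "\<And>e. e \<in> I \<Longrightarrow> l (b e) \<le> i \<and> i \<le> l (a e)" for I i
    by (rule bound[of b I a i]) (use that ab abV in \<open>auto simp: insert_commute\<close>)
  have "\<not> k_crossing G D (2 * w + 1) M" for M
  proof
    assume M: "k_crossing G D (2 * w + 1) M"
    then have M': "M \<subseteq> edges G" "finite M" "card M = 2 * w + 1"
      and "pairwise (crosses D) M"
      unfolding k_crossing_def by auto
    then have pw: "lt e f \<or> lt f e" if "e \<in> M" "f \<in> M" "e \<noteq> f" for e f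
      using crosses that unfolding pairwise_def by blast
    have inj: "inj_on a M" "inj_on b M"
      using pw unfolding lt_def inj_on_def by (metis less_irrefl)+
    have ord: "l (a e) \<le> l (a f) \<and> l (b f) \<le> l (b e) \<or> l (a f) \<le> l (a e) \<and> l (b e) \<le> l (b f)"
      if "e \<in> M" "f \<in> M" "e \<noteq> f" for e f
      using pw[OF that] ltl that M'(1) by blast
    \<comment> \<open>Edges are separated by the end that starts first. Each class has a common
      index and so at most \<open>w\<close> edges, which gives the bound
      \<open>2 * w\<close>.\<close>
    define M1 where "M1 = {e \<in> M. l (a e) \<le> l (b e)}"
    define M2 where "M2 = {e \<in> M. l (b e) < l (a e)}"
    have sub: "M1 \<subseteq> M" "M2 \<subseteq> M" unfolding M1_def M2_def by auto
    have "card M1 \<le> w"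
    proof (cases "M1 = {}")
      case False
      have "\<exists>i. \<forall>e\<in>M1. l (a e) \<le> i \<and> i \<le> l (b e)"
        using False M'(2) ord by (intro crossing_edges_common_bag) (auto simp: M1_def)
      then show ?thesis
        using bound_a[of M1] sub(1) M'(1) inj(1) by (meson inj_on_subset subset_trans)
    qed simp
    moreover have "card M2 \<le> w"
    proof (cases "M2 = {}")
      case False
      have "\<exists>i. \<forall>e\<in>M2. l (b e) \<le> i \<and> i \<le> l (a e)"
        using False M'(2) ord by (intro crossing_edges_common_bag) (auto simp: M2_def)
      then show ?thesis
        using bound_b[of M2] sub(2) M'(1) inj(2) by (meson inj_on_subset subset_trans)
    qed simp
    moreover have "card M \<le> card M1 + card M2"
    proof -
      have "M = M1 \<union> M2" unfolding M1_def M2_def by auto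
      then show ?thesis by (metis card_Un_le)
    qed
    ultimately show False using M'(3) by simp
  qed
  moreover have "\<not> st_crossing G D (w + 1) (w + 1) S T" for S T
  proof
    assume ST: "st_crossing G D (w + 1) (w + 1) S T"
    have matching_inj: "inj_on a M \<and> inj_on b M" if "M \<subseteq> edges G" "pairwise disjnt M" for M
    proof -
      have "e = f" if "e \<in> M" "f \<in> M" "a e = a f \<or> b e = b f" for e f
      proof (rule ccontr)
        assume "e \<noteq> f"
        then have "e \<inter> f = {}"
          using \<open>pairwise disjnt M\<close> that unfolding pairwise_def disjnt_def by blast
        moreover have "{a e, b e} = e" "{a f, b f} = f"
          using ab that \<open>M \<subseteq> edges G\<close> by blast+
        ultimately show False using that(3) by blast
      qed
      then show ?thesis unfolding inj_on_def by blast
    qed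
    \<comment> \<open>Two edges of a non-crossing matching have the same order on both lines. An
      edge crossing them in different ways would contradict this order on one of the lines.\<close>
    have same: "lt e f' \<longleftrightarrow> lt e f" "lt f' e \<longleftrightarrow> lt f e"
      if M: "M \<subseteq> edges G" "pairwise disjnt M" "\<And>f f'. f \<in> M \<Longrightarrow> f' \<in> M \<Longrightarrow> \<not> lt f f'"
        and f: "f \<in> M" "f' \<in> M" and cr: "lt e f \<or> lt f e" "lt e f' \<or> lt f' e" for M e f f'
    proof -
      have "g (a f) < g (a f') \<and> g (b f) < g (b f') \<or> g (a f') < g (a f) \<and> g (b f') < g (b f)"
        if "f \<noteq> f'"
      proof -
        have "a f \<noteq> a f'" "b f \<noteq> b f'"
          using matching_inj[OF M(1,2)] f that unfolding inj_on_def by auto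
        then have "g (a f) \<noteq> g (a f')" "g (b f) \<noteq> g (b f')"
          using g abV f M(1) unfolding inj_on_def by (meson subsetD)+
        moreover have "\<not> lt f f'" "\<not> lt f' f"
          using M(3) f by auto
        ultimately show ?thesis
          unfolding lt_def by linarith
      qed
      then show "lt e f' \<longleftrightarrow> lt e f" "lt f' e \<longleftrightarrow> lt f e"
        using cr unfolding lt_def by (cases "f = f'", simp, linarith)+
    qed
    \<comment> \<open>Compare the first start \<open>l (a n)\<close> of an \<open>A\<close>-end in
      \<open>T\<close> with the first start \<open>l (b m)\<close> of a \<open>B\<close>-end in
      \<open>S\<close>. If the former is not later, the \<open>A\<close>-ends of all edges of
      \<open>S\<close> lie in bag \<open>l (a n)\<close>; otherwise the \<open>B\<close>-ends of all
      edges of \<open>T\<close> lie in bag \<open>l (b m)\<close>. Either way there are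
      \<open>w + 1\<close> vertices in one bag.\<close>
    have no: False if S: "S \<subseteq> edges G" "finite S" "card S = w + 1" "pairwise disjnt S"
      and T: "T \<subseteq> edges G" "finite T" "card T = w + 1" "pairwise disjnt T"
      and lt: "\<And>e f. e \<in> S \<Longrightarrow> f \<in> T \<Longrightarrow> lt e f" for S T
    proof -
      have "S \<noteq> {}" "T \<noteq> {}" using S(3) T(3) by auto
      then obtain m n where m: "m \<in> S" "\<And>e. e \<in> S \<Longrightarrow> l (b m) \<le> l (b e)"
        and n: "n \<in> T" "\<And>f. f \<in> T \<Longrightarrow> l (a n) \<le> l (a f)"
        using ex_has_least_nat[of "\<lambda>e. e \<in> S" _ "\<lambda>e. l (b e)"]
          ex_has_least_nat[of "\<lambda>e. e \<in> T" _ "\<lambda>e. l (a e)"] by blast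
      show False
      proof (cases "l (a n) \<le> l (b m)")
        case True
        have "card S \<le> w"
        proof (rule bound_a[of S "l (a n)"])
          fix e assume e: "e \<in> S"
          then show "l (a e) \<le> l (a n) \<and> l (a n) \<le> l (b e)"
            using ltl[OF lt[OF e n(1)]] m(2)[OF e] True S(1) T(1) n(1) by fastforce
        qed (use S matching_inj in auto)
        then show False using S(3) by simp
      next
        case False
        have "card T \<le> w"
        proof (rule bound_b[of T "l (b m)"])
          fix f assume f: "f \<in> T"
          then show "l (b f) \<le> l (b m) \<and> l (b m) \<le> l (a f)"
            using ltl[OF lt[OF m(1) f]] n(2)[OF f] False S(1) T(1) m(1) by fastforce
        qed (use T matching_inj in auto)
        then show False using T(3) by simp
      qed
    qed
    have S: "S \<subseteq> edges G" "finite S" "card S = w + 1" "pairwise disjnt S"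
      and T: "T \<subseteq> edges G" "finite T" "card T = w + 1" "pairwise disjnt T"
      using ST unfolding st_crossing_def k_matching_def by auto
    have ncS: "\<not> lt e f" if "e \<in> S" "f \<in> S" for e f
    proof -
      have "\<not> crosses D e f"
        using ST that unfolding st_crossing_def non_crossing_def by simp
      then show ?thesis
        using crosses[of e f] S(1) that by auto
    qed
    have ncT: "\<not> lt e f" if "e \<in> T" "f \<in> T" for e f
    proof -
      have "\<not> crosses D e f"
        using ST that unfolding st_crossing_def non_crossing_def by simp
      then show ?thesis
        using crosses[of e f] T(1) that by auto
    qed
    have cr: "lt e f \<or> lt f e" if "e \<in> S" "f \<in> T" for e f
    proof -
      have "crosses D e f"
        using ST that unfolding st_crossing_def by simp
      then show ?thesis
        using crosses[of e f] S(1) T(1) that by auto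
    qed
    obtain e0 f0 where ef: "e0 \<in> S" "f0 \<in> T"
      using S(3) T(3) by fastforce
    \<comment> \<open>The way of crossing is transferred first along \<open>T\<close> from
      \<open>f\<close> to \<open>f0\<close>, then along \<open>S\<close> from \<open>e\<close> to
      \<open>e0\<close>.\<close>
    have all: "(lt e f \<longleftrightarrow> lt e0 f0) \<and> (lt f e \<longleftrightarrow> lt f0 e0)" if "e \<in> S" "f \<in> T" for e f
      using same[OF T(1,4) ncT, of f f0 e] same[OF S(1,4) ncS, of e e0 f0] cr[of e f] cr[of e f0]
        cr[of e0 f0] that ef by blast
    show False
    proof (cases "lt e0 f0")
      case True
      show False
        by (rule no[OF S T]) (use all True in blast)
    next
      case False
      then have "lt f0 e0" using cr ef by blast
      show False
        by (rule no[OF T S]) (use all \<open>lt f0 e0\<close> in blast)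
    qed
  qed
  ultimately show ?thesis using drawing by blast
qed

section \<open>Uniform bounds over a class of graphs\<close>

theorem corollary4:
  fixes \<G> :: "'a graph set"
  assumes "\<forall>G\<in>\<G>. finite_simple_graph G \<and> bipartite G"
  shows "bounded_pathwidth \<G> \<longleftrightarrow>
    (\<exists>k s t :: nat. k \<ge> 1 \<and> s \<ge> 1 \<and> t \<ge> 1 \<and>
      (\<forall>G\<in>\<G>. \<exists>D. two_layer_drawing G D \<and>
        (\<nexists>M. k_crossing G D k M) \<and>
        (\<nexists>S T. st_crossing G D s t S T)))"
proof
  assume "bounded_pathwidth \<G>"
  then obtain c where c: "\<forall>G\<in>\<G>. pathwidth G \<le> c"
    unfolding bounded_pathwidth_def by blast
  \<comment> \<open>\<open>w\<close> bounds the bag sizes, which exceed the width by one. It may be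
    0, but \<open>2 * w + 1\<close> and \<open>w + 1\<close> are positive in any case.\<close>
  define w where "w = nat (c + 1)"
  have "\<exists>D. two_layer_drawing G D \<and> (\<nexists>M. k_crossing G D (2 * w + 1) M) \<and>
    (\<nexists>S T. st_crossing G D (w + 1) (w + 1) S T)" if G: "G \<in> \<G>" for G
  proof -
    have fsg: "finite_simple_graph G" "bipartite G"
      using assms G by auto
    obtain Bs where Bs: "path_decomposition G Bs" "decomposition_width Bs = pathwidth G"
      using pathwidth_attained(1)[OF fsg(1)] by blast
    then have "int (Max (card ` set Bs)) \<le> c + 1"
      using c G unfolding decomposition_width_def by force
    then have "Max (card ` set Bs) \<le> w"
      unfolding w_def by linarith
    then have "card X \<le> w" if "X \<in> set Bs" for X
      using that by (meson List.finite_set Max_ge finite_imageI image_eqI le_trans)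
    then show ?thesis
      by (rule drawing_if_path_decomposition[OF fsg Bs(1)])
  qed
  then show "\<exists>k s t :: nat. k \<ge> 1 \<and> s \<ge> 1 \<and> t \<ge> 1 \<and>
      (\<forall>G\<in>\<G>. \<exists>D. two_layer_drawing G D \<and>
        (\<nexists>M. k_crossing G D k M) \<and> (\<nexists>S T. st_crossing G D s t S T))"
    by (intro exI[of _ "2 * w + 1"] exI[of _ "w + 1"]) auto
next
  assume "\<exists>k s t :: nat. k \<ge> 1 \<and> s \<ge> 1 \<and> t \<ge> 1 \<and>
      (\<forall>G\<in>\<G>. \<exists>D. two_layer_drawing G D \<and>
        (\<nexists>M. k_crossing G D k M) \<and> (\<nexists>S T. st_crossing G D s t S T))"
  then obtain k s t where D: "\<And>G. G \<in> \<G> \<Longrightarrow> \<exists>D. two_layer_drawing G D \<and>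
        (\<nexists>M. k_crossing G D k M) \<and> (\<nexists>S T. st_crossing G D s t S T)"
    by blast
  obtain c where "\<And>(G :: 'a graph) D. finite_simple_graph G \<Longrightarrow> two_layer_drawing G D \<Longrightarrow>
    (\<nexists>M. k_crossing G D k M) \<Longrightarrow> (\<nexists>S T. st_crossing G D s t S T) \<Longrightarrow> pathwidth G \<le> c"
    using pathwidth_bounded_if_drawing[of k s t] by blast
  then show "bounded_pathwidth \<G>"
    using D assms unfolding bounded_pathwidth_def by blast
qed

end
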